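(* Consider Brochette first-passage percolation on $\mathbb{Z}^d$, $d\ge 2$, with passage time distribution function $F$, and let $a$ be the infimum of the support of this distribution. Assume that $\mathbb{E}[\min(\tau_1,\dots,\tau_d)]<+\infty$, where $\tau_1,\dots,\tau_d$ are $d$ independent random variables with distribution function $F$. Then for every $x\in\mathbb{Z}^d$, $$\lim_{n\to+\infty}\frac{T(0,nx)}{n}=a\lVert x\rVert_1\quad\text{almost surely and in }L^1.$$
   Context: Brochette first-passage percolation: let $\mathbb{E}^d$ be the set of edges $\{x,y\}$ with $x,y\in\mathbb{Z}^d$, $\lVert x-y\rVert_1=1$. An integer line is the set of points of $\mathbb{Z}^d$ lying on a common line of $\mathbb{R}^d$ parallel to one of the coordinate axes; $\Delta$ is the set of integer lines. Let $(\tau_\delta)_{\delta\in\Delta}$ be i.i.d. random variables with values in $[0,+\infty)$ and common cumulative distribution function $F$. The passage time $\tau_e$ of an edge $e\in\mathbb{E}^d$ is $\tau_e=\tau_\delta$, where $\delta$ is the unique integer line containing both endpoints of $e$. The infimum $a\ge 0$ of the support is characterized by $F(a+\eta)>0$ and $F(a-\eta)=0$ for all $\eta>0$. For $x,y\in\mathbb{Z}^d$, $T(x,y)=\inf_\Gamma\sum_{e\in\Gamma}\tau_e$, the infimum being over finite nearest-neighbour paths $\Gamma$ from $x$ to $y$ (so $T(x,x)=0$). *)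

theory Defs
  imports "HOL-Probability.Probability"
begin

definition norm1 :: "int ^ 'd::finite \<Rightarrow> int" where
  "norm1 x = (\<Sum>i\<in>UNIV. \<bar>x $ i\<bar>)"

definition lattice_edges :: "(int ^ 'd::finite) set set" where
  "lattice_edges = {{x, y} | x y. norm1 (x - y) = 1}"

definition integer_lines :: "(int ^ 'd::finite) set set" where
  "integer_lines = {{y. \<forall>j. j \<noteq> i \<longrightarrow> y $ j = p $ j} | i p. True}"

definition line_of_edge :: "(int ^ 'd::finite) set \<Rightarrow> (int ^ 'd) set" where
  "line_of_edge e = (THE \<delta>. \<delta> \<in> integer_lines \<and> e \<subseteq> \<delta>)"

definition lattice_path :: "int ^ 'd::finite \<Rightarrow> int ^ 'd \<Rightarrow> (int ^ 'd) list \<Rightarrow> bool" where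
  "lattice_path x y vs \<longleftrightarrow> vs \<noteq> [] \<and> hd vs = x \<and> last vs = y \<and>
     successively (\<lambda>u v. {u, v} \<in> lattice_edges) vs"

definition path_edges :: "'v list \<Rightarrow> 'v set list" where
  "path_edges vs = map (\<lambda>(u, v). {u, v}) (zip vs (tl vs))"

text \<open>Here \<open>t\<close> assigns a passage time to each integer line. An edge used several times by a path is
  counted with multiplicity. For \<open>t \<ge> 0\<close> the infimum in \<open>passage_time\<close> is over a set that is bounded
  below, and nonempty because the lattice is connected; the one-vertex path has time 0.\<close>

definition path_time :: "((int ^ 'd::finite) set \<Rightarrow> real) \<Rightarrow> (int ^ 'd) list \<Rightarrow> real" where
  "path_time t vs = (\<Sum>e\<leftarrow>path_edges vs. t (line_of_edge e))"

definition passage_time ::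
    "((int ^ 'd::finite) set \<Rightarrow> real) \<Rightarrow> int ^ 'd \<Rightarrow> int ^ 'd \<Rightarrow> real" where
  "passage_time t x y = (INF vs \<in> Collect (lattice_path x y). path_time t vs)"

definition measure_support :: "'a::topological_space measure \<Rightarrow> 'a set" where
  "measure_support \<mu> = {x. \<forall>U. open U \<longrightarrow> x \<in> U \<longrightarrow> emeasure \<mu> U > 0}"

definition inf_support :: "(real \<Rightarrow> real) \<Rightarrow> real" where
  "inf_support F = Inf (measure_support (interval_measure F))"

text \<open>The definite description in \<open>line_of_edge\<close> is proper.\<close>

lemma norm1_eq_1D:
  assumes "norm1 (x - y) = 1"
  obtains i where "x $ i \<noteq> y $ i" "\<And>j. j \<noteq> i \<Longrightarrow> x $ j = y $ j"
proof -
  have "\<exists>i. x $ i \<noteq> y $ i"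
    using assms unfolding norm1_def by (rule contrapos_pp) simp
  then obtain i where i: "x $ i \<noteq> y $ i" by blast
  moreover have "x $ j = y $ j" if "j \<noteq> i" for j
  proof -
    have "(\<Sum>k\<in>{i, j}. \<bar>(x - y) $ k\<bar>) \<le> norm1 (x - y)"
      unfolding norm1_def by (rule sum_mono2) auto
    with assms i that show ?thesis by simp
  qed
  ultimately show thesis using that by blast
qed

lemma line_of_edge_unique:
  assumes "e \<in> lattice_edges"
  shows "\<exists>!\<delta>. \<delta> \<in> integer_lines \<and> e \<subseteq> \<delta>"
proof -
  obtain x y where e: "e = {x, y}" and xy: "norm1 (x - y) = 1"
    using assms unfolding lattice_edges_def by blast
  obtain i where i: "x $ i \<noteq> y $ i" "\<And>j. j \<noteq> i \<Longrightarrow> x $ j = y $ j"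
    using norm1_eq_1D[OF xy] by blast
  let ?L = "{z. \<forall>j. j \<noteq> i \<longrightarrow> z $ j = x $ j}"
  show ?thesis
  proof (rule ex1I[of _ ?L])
    show "?L \<in> integer_lines \<and> e \<subseteq> ?L"
      using i(2) unfolding e integer_lines_def by auto
  next
    fix \<delta> assume a: "\<delta> \<in> integer_lines \<and> e \<subseteq> \<delta>"
    then obtain k p where d: "\<delta> = {z. \<forall>j. j \<noteq> k \<longrightarrow> z $ j = p $ j}"
      unfolding integer_lines_def by blast
    have 1: "\<forall>j. j \<noteq> k \<longrightarrow> x $ j = p $ j" "\<forall>j. j \<noteq> k \<longrightarrow> y $ j = p $ j"
      using a unfolding e d by auto
    then have "k = i" using i(1) by metis
    then show "\<delta> = ?L" unfolding d using 1(1) by auto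
  qed
qed

text \<open>For the law of a nonnegative real random variable, the infimum of the support is the point
  \<open>a \<ge> 0\<close> with \<open>F (a + \<eta>) > 0\<close> and \<open>F (a - \<eta>) = 0\<close> for all \<open>\<eta> > 0\<close>.\<close>

lemma inf_support_characterization:
  assumes mono: "\<And>x y. x \<le> y \<Longrightarrow> F x \<le> F y"
    and rc: "\<And>x. continuous (at_right x) F"
    and top: "(F \<longlongrightarrow> 1) at_top"
    and neg: "\<And>x. x < 0 \<Longrightarrow> F x = 0"
  shows "inf_support F = a \<longleftrightarrow> a \<ge> 0 \<and> (\<forall>\<eta>>0. F (a + \<eta>) > 0 \<and> F (a - \<eta>) = 0)"
proof -
  let ?\<mu> = "interval_measure F"
  let ?S = "measure_support ?\<mu>"
  have bot: "(F \<longlongrightarrow> 0) at_bot"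
    by (rule tendsto_eventually) (auto simp: eventually_at_bot_linorder neg intro!: exI[of _ "-1"])
  have Iic: "emeasure ?\<mu> {..x} = ennreal (F x)" for x
    by (rule emeasure_interval_measure_Iic[OF mono rc bot])
  have Ioc: "emeasure ?\<mu> {x<..y} = ennreal (F y - F x)" if "x \<le> y" for x y
    by (rule emeasure_interval_measure_Ioc[OF that mono rc])
  have nonneg: "F x \<ge> 0" for x
    by (metis mono neg less_eq_real_def linorder_not_le zero_less_one order_trans minus_less_iff
        neg_less_0_iff_less linorder_linear lt_ex)
  have key: "Inf ?S = b" if b: "b \<ge> 0" "\<forall>\<eta>>0. F (b + \<eta>) > 0 \<and> F (b - \<eta>) = 0" for b
  proof (rule cInf_eq_minimum)
    show "b \<in> ?S"
      unfolding measure_support_def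
    proof (safe)
      fix U assume U: "open U" "b \<in> U"
      obtain e where e: "e > 0" "ball b e \<subseteq> U" using U openE by blast
      have s: "{b - e/2 <.. b + e/2} \<subseteq> U"
        using e by (auto simp: ball_def dist_real_def subset_iff abs_if)
      have "0 < emeasure ?\<mu> {b - e/2 <.. b + e/2}"
        using b(2)[rule_format, of "e/2"] e(1) by (subst Ioc) auto
      also have "\<dots> \<le> emeasure ?\<mu> U"
        by (rule emeasure_mono[OF s]) (use U in auto)
      finally show "0 < emeasure ?\<mu> U" .
    qed
    fix x assume x: "x \<in> ?S"
    show "b \<le> x"
    proof (rule ccontr)
      assume "\<not> b \<le> x"
      define z where "z = (b + x) / 2"
      have z: "x < z" "z < b" using \<open>\<not> b \<le> x\<close> by (auto simp: z_def)
      have "emeasure ?\<mu> {..<z} > 0"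
        using x z unfolding measure_support_def by auto
      also have "emeasure ?\<mu> {..<z} \<le> emeasure ?\<mu> {..z}"
        by (rule emeasure_mono) auto
      also have "\<dots> = 0" using b(2)[rule_format, of "b - z"] z by (simp add: Iic)
      finally show False by simp
    qed
  qed
  define c where "c = Inf {x. F x > 0}"
  have ne: "{x. F x > 0} \<noteq> {}"
  proof -
    have "eventually (\<lambda>x. F x > 0) at_top" using order_tendstoD(1)[OF top, of 0] by simp
    then show ?thesis using eventually_happens[of _ "at_top :: real filter"] by fastforce
  qed
  have lb: "0 \<le> x" if "F x > 0" for x using that neg[of x] by (cases "x < 0") auto
  have bdd: "bdd_below {x. F x > 0}" using lb by (auto intro!: bdd_belowI)
  have c: "c \<ge> 0 \<and> (\<forall>\<eta>>0. F (c + \<eta>) > 0 \<and> F (c - \<eta>) = 0)"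
  proof (intro conjI allI impI)
    show "c \<ge> 0" unfolding c_def using ne lb by (intro cInf_greatest) auto
    fix \<eta> :: real assume \<eta>: "\<eta> > 0"
    have "\<exists>x\<in>{x. F x > 0}. x < c + \<eta>"
      using cInf_lessD[OF ne, of "c + \<eta>"] \<eta> unfolding c_def by auto
    then show "F (c + \<eta>) > 0" using mono by (force intro: less_le_trans)
    show "F (c - \<eta>) = 0"
    proof (rule ccontr)
      assume "F (c - \<eta>) \<noteq> 0"
      then have "F (c - \<eta>) > 0" using nonneg[of "c - \<eta>"] by simp
      then have "c \<le> c - \<eta>" using bdd unfolding c_def by (intro cInf_lower) auto
      with \<eta> show False by simp
    qed
  qed
  show ?thesis unfolding inf_support_def using key key[OF _ ] c by metis
qed

end

theory Submission
  imports Defs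
begin

text \<open>The lower bound is immediate: almost surely every line has passage time at least \<open>a\<close>, and a
  path from \<open>0\<close> to \<open>n x\<close> has at least \<open>n \<parallel>x\<parallel>\<^sub>1\<close> edges.

  For the upper bound fix \<open>b > a\<close>, so that a line is cheap, i.e. has passage time at most \<open>b\<close>, with
  probability \<open>F b > 0\<close>. Since one passage time governs a whole line, a single cheap line suffices
  for an arbitrarily long straight segment; only reaching such a line can be expensive. To travel
  from \<open>u\<close> to \<open>v = u + c e\<^sub>i\<close>, choose a second axis \<open>j\<close>, leave \<open>u\<close> along the fastest of the \<open>d\<close> lines
  through it, reach \<open>u + G e\<^sub>j\<close> by cheap lines, follow the line of direction \<open>i\<close> to \<open>v + G e\<^sub>j\<close>, and
  descend to \<open>v\<close> symmetrically (\<open>reachable_within_detour\<close>). Here \<open>G \<ge> 1\<close> is the least size for which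
  at most \<open>4 d\<close> prescribed lines are all cheap. The sets of prescribed lines are disjoint for
  different sizes and contain no line through \<open>u\<close> or \<open>v\<close>
  (\<open>detour_lines_disjoint\<close>, \<open>lines_through_notin_detour_lines\<close>). Hence \<open>G\<close> has a geometric tail, is
  independent of the lines through \<open>u\<close> and of those through \<open>v\<close>, and the cost exceeds \<open>b \<bar>c\<bar>\<close> by at
  most \<open>G (Y\<^sub>u + 2 b) + G (Y\<^sub>v + 2 b)\<close>, where \<open>Y\<^sub>w\<close>, the minimum over the lines through \<open>w\<close>, is
  distributed as \<open>min (\<tau>\<^sub>1, \<dots>, \<tau>\<^sub>d)\<close>.

  Settling one coordinate after the other gives \<open>T(0, z) \<le> b \<parallel>z\<parallel>\<^sub>1 + R\<^sub>z\<close>, where the tail of \<open>R\<^sub>z\<close> is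
  bounded uniformly in \<open>z\<close> (\<open>emeasure_excess_le\<close>) by a function that is summable along arithmetic
  progressions, because the minimum is integrable (\<open>suminf_excess_bound_finite\<close>). This uniform
  bound serves twice: with Borel--Cantelli it yields \<open>R\<^sub>n\<^sub>x \<le> \<epsilon> n\<close> for all large \<open>n\<close> almost surely, and
  it bounds the expectation of \<open>R\<^sub>n\<^sub>x\<close> by a constant, whence the convergence in \<open>L\<^sup>1\<close>.\<close>

section \<open>Integer lines and lattice paths\<close>

definition line_through :: "'d::finite \<Rightarrow> int ^ 'd \<Rightarrow> (int ^ 'd) set" where
  "line_through i p = {y. \<forall>j. j \<noteq> i \<longrightarrow> y $ j = p $ j}"

lemma line_through_in_integer_lines [simp]: "line_through i p \<in> integer_lines"
  unfolding line_through_def integer_lines_def by blast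

lemma line_through_eqD:
  assumes "line_through i p = line_through k q"
  shows "i = k" and "\<And>j. j \<noteq> i \<Longrightarrow> p $ j = q $ j"
proof -
  have "p \<in> line_through k q" "p + axis i 1 \<in> line_through k q"
    unfolding assms [symmetric] by (auto simp: line_through_def axis_def)
  then have pq: "\<forall>j. j \<noteq> k \<longrightarrow> p $ j = q $ j" "\<forall>j. j \<noteq> k \<longrightarrow> (p + axis i 1) $ j = q $ j"
    by (auto simp: line_through_def)
  show "i = k"
  proof (rule ccontr)
    assume "i \<noteq> k"
    with pq have "p $ i = (p + axis i 1) $ i" by metis
    then show False by (simp add: axis_def)
  qed
  then show "\<And>j. j \<noteq> i \<Longrightarrow> p $ j = q $ j" using pq(1) by simp
qed

lemma line_through_eqI:
  assumes "\<And>j. j \<noteq> i \<Longrightarrow> p $ j = q $ j"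
  shows "line_through i p = line_through i q"
  using assms by (auto simp: line_through_def)

lemma line_of_edge_in_integer_lines:
  "e \<in> lattice_edges \<Longrightarrow> line_of_edge e \<in> integer_lines"
  unfolding line_of_edge_def using theI' [OF line_of_edge_unique] by blast

lemma norm1_axis [simp]: "norm1 (axis i c) = \<bar>c\<bar>"
proof -
  have "norm1 (axis i c) = (\<Sum>k\<in>UNIV. if k = i then \<bar>c\<bar> else 0)"
    unfolding norm1_def by (intro sum.cong) (auto simp: axis_def)
  then show ?thesis by simp
qed

lemma unit_step_edge:
  assumes "\<bar>c\<bar> = 1"
  shows "{p, p + axis i c} \<in> lattice_edges"
proof -
  have "norm1 ((p + axis i c) - p) = 1" using assms by simp
  then show ?thesis unfolding lattice_edges_def by blast
qed

lemma line_of_unit_step: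
  assumes "\<bar>c\<bar> = 1"
  shows "line_of_edge {p, p + axis i c} = line_through i p"
  unfolding line_of_edge_def
proof (rule the1_equality [OF line_of_edge_unique [OF unit_step_edge [OF assms]]])
  have "{p, p + axis i c} \<subseteq> line_through i p" by (auto simp: line_through_def axis_def)
  then show "line_through i p \<in> integer_lines \<and> {p, p + axis i c} \<subseteq> line_through i p" by simp
qed

lemma countable_integer_lines: "countable (integer_lines :: (int ^ 'd::finite) set set)"
proof -
  have "(integer_lines :: (int ^ 'd) set set) = (\<Union>i\<in>UNIV. range (line_through i))"
    unfolding integer_lines_def line_through_def by auto
  moreover have "countable (\<Union>i\<in>(UNIV :: 'd set). range (line_through i))"
    by (intro countable_UN countable_finite [OF finite] countable_image countableI_type)
  ultimately show ?thesis by simp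
qed

lemma norm1_triangle: "norm1 (x + y) \<le> norm1 x + norm1 y"
  unfolding norm1_def sum.distrib [symmetric] by (rule sum_mono) simp

lemma path_time_singleton [simp]: "path_time t [x] = 0"
  by (simp add: path_time_def path_edges_def)

lemma path_time_Cons_Cons [simp]:
  "path_time t (x # y # vs) = t (line_of_edge {x, y}) + path_time t (y # vs)"
  by (simp add: path_time_def path_edges_def)

lemma lattice_path_singleton [simp]: "lattice_path x y [v] \<longleftrightarrow> v = x \<and> v = y"
  by (auto simp: lattice_path_def)

lemma lattice_path_Cons_Cons [simp]:
  "lattice_path x z (v # w # vs) \<longleftrightarrow>
     v = x \<and> {v, w} \<in> lattice_edges \<and> lattice_path w z (w # vs)"
  by (auto simp: lattice_path_def)

text \<open>A path has at least as many edges as the \<open>\<ell>\<^sup>1\<close> distance of its endpoints, and each of them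
  costs at least the cheapest line.\<close>

lemma path_time_ge_norm1:
  assumes t: "\<And>\<delta>. \<delta> \<in> integer_lines \<Longrightarrow> a \<le> t \<delta>" and a: "0 \<le> a"
    and "lattice_path x y vs"
  shows "a * of_int (norm1 (y - x)) \<le> path_time t vs"
  using assms(3)
proof (induction vs arbitrary: x rule: induct_list012)
  case 1
  then show ?case by (simp add: lattice_path_def)
next
  case (2 v)
  then have "y = x" by auto
  then show ?case by (simp add: norm1_def)
next
  case (3 v w vs)
  have v: "v = x" "{v, w} \<in> lattice_edges" "lattice_path w y (w # vs)" using "3.prems" by auto
  obtain p q where "{v, w} = {p, q}" "norm1 (p - q) = 1"
    using v(2) unfolding lattice_edges_def by blast
  moreover have "norm1 (q - p) = norm1 (p - q)" unfolding norm1_def by (simp add: abs_minus_commute)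
  ultimately have 1: "norm1 (w - v) = 1" by (auto simp: doubleton_eq_iff)
  have "norm1 (y - x) \<le> 1 + norm1 (y - w)"
    using norm1_triangle [of "w - v" "y - w"] 1 v(1) by simp
  then have "a * of_int (norm1 (y - x)) \<le> a * of_int (1 + norm1 (y - w))"
    using a by (intro mult_left_mono) (simp_all only: of_int_le_iff)
  also have "\<dots> = a + a * of_int (norm1 (y - w))" by (simp add: algebra_simps)
  also have "\<dots> \<le> t (line_of_edge {v, w}) + path_time t (w # vs)"
    using t [OF line_of_edge_in_integer_lines [OF v(2)]] "3.IH"(2) [OF v(3)] by simp
  finally show ?case by simp
qed

text \<open>Upper bounds are handled through this relation rather than through the infimum itself: it
  composes along concatenation without knowing beforehand that any path exists.\<close>

definition reachable_within ::
    "((int ^ 'd::finite) set \<Rightarrow> real) \<Rightarrow> int ^ 'd \<Rightarrow> int ^ 'd \<Rightarrow> real \<Rightarrow> bool" where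
  "reachable_within t x y c \<longleftrightarrow> (\<exists>vs. lattice_path x y vs \<and> path_time t vs \<le> c)"

lemma reachable_within_mono:
  "reachable_within t x y c \<Longrightarrow> c \<le> c' \<Longrightarrow> reachable_within t x y c'"
  unfolding reachable_within_def by force

lemma reachable_within_refl: "0 \<le> c \<Longrightarrow> reachable_within t x x c"
  unfolding reachable_within_def by (intro exI [of _ "[x]"]) simp

lemma reachable_within_edge:
  "{x, y} \<in> lattice_edges \<Longrightarrow> reachable_within t x y (t (line_of_edge {x, y}))"
  unfolding reachable_within_def by (intro exI [of _ "[x, y]"]) simp

lemma reachable_within_trans:
  assumes "reachable_within t x y c" "reachable_within t y z c'"
  shows "reachable_within t x z (c + c')"
proof -
  obtain ws where ws: "lattice_path y z ws" "path_time t ws \<le> c'"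
    using assms(2) unfolding reachable_within_def by blast
  have "\<exists>us. lattice_path x z us \<and> path_time t us = path_time t vs + path_time t ws"
    if "lattice_path x y vs" for vs
    using that
  proof (induction vs arbitrary: x rule: induct_list012)
    case 1
    then show ?case by (simp add: lattice_path_def)
  next
    case (2 v)
    then have "x = y" by auto
    then show ?case using ws(1) by (intro exI [of _ ws]) simp
  next
    case (3 v w vs)
    then have v: "v = x" "{v, w} \<in> lattice_edges" "lattice_path w y (w # vs)" by auto
    obtain us where us: "lattice_path w z us" "path_time t us = path_time t (w # vs) + path_time t ws"
      using "3.IH"(2) [OF v(3)] by blast
    obtain us' where "us = w # us'" using us(1) by (cases us) (auto simp: lattice_path_def)
    then show ?case using us v(1,2) by (intro exI [of _ "v # us"]) simp
  qed
  then show ?thesis using assms(1) ws(2) unfolding reachable_within_def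
    by (metis add_mono)
qed

lemma path_time_nonneg:
  assumes "\<And>\<delta>. \<delta> \<in> integer_lines \<Longrightarrow> 0 \<le> t \<delta>" "lattice_path x y vs"
  shows "0 \<le> path_time t vs"
  using path_time_ge_norm1 [of 0 t x y vs] assms by simp

lemma passage_time_le:
  assumes t: "\<And>\<delta>. \<delta> \<in> integer_lines \<Longrightarrow> 0 \<le> t \<delta>" and "reachable_within t x y c"
  shows "passage_time t x y \<le> c"
proof -
  obtain vs where vs: "lattice_path x y vs" "path_time t vs \<le> c"
    using assms(2) unfolding reachable_within_def by blast
  have "passage_time t x y \<le> path_time t vs"
    unfolding passage_time_def
    using vs(1) path_time_nonneg [OF t] by (intro cINF_lower bdd_belowI2 [of _ 0]) auto
  with vs(2) show ?thesis by simp
qed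

lemma reachable_within_along_line:
  "reachable_within t p (p + axis i c) (of_int \<bar>c\<bar> * t (line_through i p))"
proof -
  have step: "reachable_within t p (p + axis i (s * int n)) (real n * t (line_through i p))"
    if s: "\<bar>s\<bar> = 1" for s n
  proof (induction n)
    case 0
    then show ?case by (simp add: axis_def vec_eq_iff reachable_within_refl zero_vec_def [symmetric])
  next
    case (Suc n)
    let ?q = "p + axis i (s * int n)"
    have q: "?q + axis i s = p + axis i (s * int (Suc n))"
      by (auto simp: vec_eq_iff axis_def algebra_simps)
    have "line_through i ?q = line_through i p"
      by (rule line_through_eqI) (auto simp: axis_def)
    then have "reachable_within t ?q (?q + axis i s) (t (line_through i p))"
      using reachable_within_edge [OF unit_step_edge [OF s, of ?q i], of t]
        line_of_unit_step [OF s, of ?q i] by simp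
    from reachable_within_trans [OF Suc this] show ?case unfolding q by (simp add: algebra_simps)
  qed
  have "\<bar>sgn c\<bar> = 1 \<or> c = 0" by (auto simp: sgn_if)
  then show ?thesis
  proof
    assume "\<bar>sgn c\<bar> = 1"
    from step [OF this, of "nat \<bar>c\<bar>"] show ?thesis by (simp add: sgn_mult_abs)
  next
    assume "c = 0"
    then show ?thesis using step [of 1 0] by simp
  qed
qed

lemma reachable_within_cheap_line:
  assumes "t (line_through i p) \<le> b" "real_of_int \<bar>c\<bar> \<le> k" "0 \<le> b" "q = p + axis i c"
  shows "reachable_within t p q (k * b)" and "reachable_within t q p (k * b)"
proof -
  have "real_of_int \<bar>c\<bar> * t (line_through i p) \<le> real_of_int \<bar>c\<bar> * b"
    using assms(1) by (intro mult_left_mono) auto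
  also have "\<dots> \<le> k * b" using assms by (intro mult_right_mono) auto
  finally have *: "real_of_int \<bar>c\<bar> * t (line_through i p) \<le> k * b" .
  then show "reachable_within t p q (k * b)"
    using reachable_within_along_line assms(4) reachable_within_mono by blast
  have "line_through i q = line_through i p"
    unfolding assms(4) by (rule line_through_eqI) (auto simp: axis_def)
  moreover have "q + axis i (- c) = p" unfolding assms(4) by (auto simp: vec_eq_iff axis_def)
  ultimately show "reachable_within t q p (k * b)"
    using reachable_within_along_line [of t q i "- c"] * reachable_within_mono by fastforce
qed

text \<open>Truncations to coordinate subsets serve as the intermediate points of a path that settles one
  coordinate after the other.\<close>

definition restrict_coords :: "'d::finite set \<Rightarrow> int ^ 'd \<Rightarrow> int ^ 'd" where
  "restrict_coords S z = (\<chi> i. if i \<in> S then z $ i else 0)"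

lemma restrict_coords_empty [simp]: "restrict_coords {} z = 0"
  by (simp add: restrict_coords_def vec_eq_iff)

lemma restrict_coords_UNIV [simp]: "restrict_coords UNIV z = z"
  by (simp add: restrict_coords_def vec_eq_iff)

lemma restrict_coords_insert:
  "i \<notin> S \<Longrightarrow> restrict_coords (insert i S) z = restrict_coords S z + axis i (z $ i)"
  by (auto simp: restrict_coords_def vec_eq_iff axis_def)

lemma ex_reachable_within: "\<exists>c. reachable_within t 0 z c"
proof -
  have "\<exists>c. reachable_within t 0 (restrict_coords S z) c" for S
    using finite [of S]
  proof (induction S rule: finite_induct)
    case empty
    show ?case using reachable_within_refl [of 0] by auto
  next
    case (insert i S)
    then show ?case unfolding restrict_coords_insert [OF insert.hyps(2)]
      using reachable_within_trans reachable_within_along_line by metis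
  qed
  from this [of UNIV] show ?thesis by simp
qed

lemma passage_time_ge_norm1:
  assumes t: "\<And>\<delta>. \<delta> \<in> integer_lines \<Longrightarrow> a \<le> t \<delta>" and a: "0 \<le> a"
  shows "a * of_int (norm1 z) \<le> passage_time t 0 z"
proof -
  have "Collect (lattice_path 0 z) \<noteq> {}"
    using ex_reachable_within [where z = z] unfolding reachable_within_def by blast
  then show ?thesis unfolding passage_time_def
    using path_time_ge_norm1 [OF t a, where x = 0 and y = z] by (intro cINF_greatest) auto
qed

section \<open>Detours along cheap lines\<close>

text \<open>Whichever line through \<open>p\<close> is the affordable one, it leads to \<open>p + G e\<^sub>j\<close>: directly
  if it has direction \<open>j\<close>, and otherwise around three sides of a square of side \<open>G\<close> of which
  only the first side lies on a line through \<open>p\<close>.\<close>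

lemma reachable_within_corner:
  fixes p :: "int ^ 'd::finite"
  assumes t: "\<And>\<delta>. \<delta> \<in> integer_lines \<Longrightarrow> 0 \<le> t \<delta>" and s: "\<bar>s\<bar> = 1"
    and far: "\<And>i. i \<noteq> j \<Longrightarrow> t (line_through i (p + axis j (int G))) \<le> b"
    and side: "\<And>i. i \<noteq> j \<Longrightarrow> t (line_through j (p + axis i (s * int G))) \<le> b"
    and near: "t (line_through i p) \<le> r" and b: "0 \<le> b"
  shows "reachable_within t p (p + axis j (int G)) (real G * (r + 2 * b))"
    and "reachable_within t (p + axis j (int G)) p (real G * (r + 2 * b))"
proof -
  let ?q = "p + axis j (int G)"
  have r: "0 \<le> r" using t [OF line_through_in_integer_lines] near by (rule order_trans)
  have "reachable_within t p ?q (real G * (r + 2 * b)) \<and>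
    reachable_within t ?q p (real G * (r + 2 * b))"
  proof (cases "i = j")
    case True
    have "reachable_within t p ?q (real G * r)" "reachable_within t ?q p (real G * r)"
      by (rule reachable_within_cheap_line [of t j p r "int G"]; use near True r in simp)+
    moreover have "real G * r \<le> real G * (r + 2 * b)" using b by (intro mult_left_mono) auto
    ultimately show ?thesis using reachable_within_mono by blast
  next
    case False
    let ?x = "p + axis i (s * int G)"
    let ?y = "?q + axis i (s * int G)"
    have G: "real_of_int \<bar>s * int G\<bar> \<le> real G" using s by (simp add: abs_mult)
    have "reachable_within t p ?x (real G * r)" "reachable_within t ?x p (real G * r)"
      by (rule reachable_within_cheap_line [of t i p r "s * int G" "real G", OF near G r], rule refl)+
    moreover have "reachable_within t ?x ?y (real G * b)" "reachable_within t ?y ?x (real G * b)"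
      by (rule reachable_within_cheap_line [of t j ?x b "int G" "real G"];
          use side [OF False] b in \<open>simp add: algebra_simps\<close>)+
    moreover have "reachable_within t ?y ?q (real G * b)" "reachable_within t ?q ?y (real G * b)"
      by (rule reachable_within_cheap_line [of t i ?q b "s * int G" "real G", OF far [OF False] G b], rule refl)+
    ultimately have "reachable_within t p ?q (real G * r + real G * b + real G * b)"
      "reachable_within t ?q p (real G * b + real G * b + real G * r)"
      using reachable_within_trans by metis+
    then show ?thesis by (simp add: algebra_simps)
  qed
  then show "reachable_within t p ?q (real G * (r + 2 * b))"
    "reachable_within t ?q p (real G * (r + 2 * b))" by auto
qed

text \<open>The lines that have to be cheap for a detour at distance \<open>G\<close> when travelling from \<open>u\<close> to \<open>v\<close>
  parallel to an axis \<open>i \<noteq> j\<close> in the direction of the sign \<open>s\<close>. The squares at \<open>u\<close> and at \<open>v\<close>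
  are placed on opposite sides, away from the segment between them; otherwise the side of direction
  \<open>j\<close> of the square at \<open>u\<close> for one \<open>G\<close> could lie on the same line as that of the square at \<open>v\<close> for
  another \<open>G\<close>.\<close>

definition detour_lines ::
    "int \<Rightarrow> 'd::finite \<Rightarrow> int ^ 'd \<Rightarrow> int ^ 'd \<Rightarrow> nat \<Rightarrow> (int ^ 'd) set set" where
  "detour_lines s j u v G =
     (\<Union>i\<in>-{j}. {line_through i (u + axis j (int G)), line_through i (v + axis j (int G)),
                line_through j (u + axis i (- s * int G)), line_through j (v + axis i (s * int G))})"

lemma finite_detour_lines: "finite (detour_lines s j u v G)"
  unfolding detour_lines_def by simp

lemma card_detour_lines_le: "card (detour_lines s j u (v :: int ^ 'd::finite) G) \<le> CARD('d) * 4"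
proof -
  have "card (detour_lines s j u v G) \<le> (\<Sum>i\<in>-{j}. 4)"
    unfolding detour_lines_def
  proof (rule order_trans [OF card_UN_le sum_mono])
    fix i
    have "card (set [line_through i (u + axis j (int G)), line_through i (v + axis j (int G)),
        line_through j (u + axis i (- s * int G)), line_through j (v + axis i (s * int G))]) \<le> 4"
      by (rule order_trans [OF card_length]) simp
    then show "card {line_through i (u + axis j (int G)), line_through i (v + axis j (int G)),
        line_through j (u + axis i (- s * int G)), line_through j (v + axis i (s * int G))} \<le> 4"
      by simp
  qed simp
  also have "\<dots> = card (-{j} :: 'd set) * 4" by simp
  also have "\<dots> \<le> CARD('d) * 4" by (intro mult_right_mono card_mono) auto
  finally show ?thesis .
qed

lemma detour_lines_subset: "detour_lines s j u v G \<subseteq> integer_lines"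
  unfolding detour_lines_def by auto

lemma reachable_within_detour:
  assumes t: "\<And>\<delta>. \<delta> \<in> integer_lines \<Longrightarrow> 0 \<le> t \<delta>" and s: "\<bar>s\<bar> = 1" and ij: "i \<noteq> j"
    and v: "v = u + axis i (s * int m)"
    and cheap: "\<And>\<delta>. \<delta> \<in> detour_lines s j u v G \<Longrightarrow> t \<delta> \<le> b" and b: "0 \<le> b"
    and near: "t (line_through k u) \<le> r" "t (line_through l v) \<le> r"
  shows "reachable_within t u v (b * real m + 2 * (real G * (r + 2 * b)))"
proof -
  let ?u = "u + axis j (int G)" and ?v = "v + axis j (int G)"
  have "reachable_within t u ?u (real G * (r + 2 * b))"
    by (rule reachable_within_corner(1) [where s = "- s" and i = k, OF t])
      (use s near b in \<open>auto intro!: cheap simp: detour_lines_def\<close>)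
  moreover have "reachable_within t ?u ?v (real m * b)"
    by (rule reachable_within_cheap_line(1) [where i = i and c = "s * int m", OF cheap])
      (use s ij b in \<open>auto simp: v abs_mult detour_lines_def algebra_simps\<close>)
  moreover have "reachable_within t ?v v (real G * (r + 2 * b))"
    by (rule reachable_within_corner(2) [where s = s and i = l, OF t])
      (use s near b in \<open>auto intro!: cheap simp: detour_lines_def\<close>)
  ultimately have "reachable_within t u v
      (real G * (r + 2 * b) + real m * b + real G * (r + 2 * b))"
    using reachable_within_trans by metis
  then show ?thesis by (simp add: algebra_simps)
qed

lemma detour_linesE:
  assumes "\<delta> \<in> detour_lines s j u v G" "i \<noteq> j" "v = u + axis i (s * int m)"
  obtains k q where "k \<noteq> j" "\<delta> = line_through k q" "q $ j = u $ j + int G"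
  | k where "k \<noteq> j" "\<delta> = line_through j (u + axis k (- s * int G))"
  | k where "k \<noteq> j" "\<delta> = line_through j (v + axis k (s * int G))"
proof -
  have "v $ j = u $ j" using assms(2,3) by (simp add: axis_def)
  then have "(w + axis j (int G)) $ j = u $ j + int G" if "w \<in> {u, v}" for w
    using that by (auto simp: axis_def)
  then show thesis using assms(1) that unfolding detour_lines_def by blast
qed

text \<open>The direction of a line tells which kind of detour line it is, and its fixed coordinates then
  determine \<open>G\<close>.\<close>

lemma detour_lines_disjoint:
  assumes s: "\<bar>s\<bar> = 1" and ij: "i \<noteq> j" and v: "v = u + axis i (s * int m)"
    and G: "0 < G" "0 < G'" "G \<noteq> G'"
  shows "detour_lines s j u v G \<inter> detour_lines s j u v G' = {}"
proof -
  have s: "s = 1 \<or> s = -1" using s by auto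
  have False if d: "\<delta> \<in> detour_lines s j u v G" and d': "\<delta> \<in> detour_lines s j u v G'" for \<delta>
    using detour_linesE [OF d ij v]
  proof cases
    case (1 k q)
    from detour_linesE [OF d' ij v] show ?thesis
      by cases (use 1 G in \<open>metis add_left_cancel line_through_eqD of_nat_eq_iff\<close>)+
  next
    case k: (2 k)
    from detour_linesE [OF d' ij v] show ?thesis
    proof cases
      case (1 k' q')
      with k show ?thesis using line_through_eqD(1) by metis
    next
      case (2 k')
      with k line_through_eqD(2) [of j "u + axis k (- s * int G)" j "u + axis k' (- s * int G')" k] s G
      show ?thesis by (auto simp: axis_def split: if_splits)
    next
      case (3 k')
      with k line_through_eqD(2) [of j "u + axis k (- s * int G)" j "v + axis k' (s * int G')" k] s G
      show ?thesis by (auto simp: v axis_def split: if_splits)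
    qed
  next
    case k: (3 k)
    from detour_linesE [OF d' ij v] show ?thesis
    proof cases
      case (1 k' q')
      with k show ?thesis using line_through_eqD(1) by metis
    next
      case (2 k')
      with k line_through_eqD(2) [of j "v + axis k (s * int G)" j "u + axis k' (- s * int G')" k'] s G
      show ?thesis by (auto simp: v axis_def split: if_splits)
    next
      case (3 k')
      with k line_through_eqD(2) [of j "v + axis k (s * int G)" j "v + axis k' (s * int G')" k] s G
      show ?thesis by (auto simp: v axis_def split: if_splits)
    qed
  qed
  then show ?thesis by blast
qed

lemma lines_through_notin_detour_lines:
  assumes s: "\<bar>s\<bar> = 1" and ij: "i \<noteq> j" and v: "v = u + axis i (s * int m)" and G: "0 < G"
    and w: "w = u \<or> w = v"
  shows "line_through k w \<notin> detour_lines s j u v G"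
proof
  have s: "s = 1 \<or> s = -1" using s by auto
  have wj: "w $ j = u $ j" using w v ij by (auto simp: axis_def)
  assume "line_through k w \<in> detour_lines s j u v G"
  then show False
  proof (rule detour_linesE [OF _ ij v], goal_cases)
    case (1 l q)
    then have "w $ j = q $ j" using line_through_eqD [of k w l q] by auto
    with wj 1 G show False by simp
  next
    case (2 l)
    then have "w $ l = (u + axis l (- s * int G)) $ l"
      using line_through_eqD [OF 2(2)] by auto
    then show False using w s G by (auto simp: v axis_def split: if_splits)
  next
    case (3 l)
    then have "w $ l = (v + axis l (s * int G)) $ l"
      using line_through_eqD [OF 3(2)] by auto
    then show False using w s G by (auto simp: v axis_def split: if_splits)
  qed
qed

section \<open>Repeated independent attempts\<close>

context prob_space
begin

lemma prob_all_greater: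
  assumes X: "indep_vars (\<lambda>_. borel) X I" and S: "finite S" "S \<noteq> {}" "S \<subseteq> I"
    and F: "\<And>i. i \<in> I \<Longrightarrow> cdf (distr M borel (X i)) = F"
  shows "prob {\<omega> \<in> space M. \<forall>i\<in>S. s < X i \<omega>} = (1 - F s) ^ card S"
proof -
  have rv: "random_variable borel (X i)" if "i \<in> I" for i
    using X that by (auto simp: indep_vars_def)
  have one: "prob (X i -` {s<..} \<inter> space M) = 1 - F s" if i: "i \<in> S" for i
  proof -
    have iI: "i \<in> I" using i S by auto
    have "F s = prob (X i -` {..s} \<inter> space M)"
      using F [OF iI] rv [OF iI] by (auto simp: cdf_def measure_distr)
    moreover have "X i -` {s<..} \<inter> space M = space M - (X i -` {..s} \<inter> space M)" by auto
    ultimately show ?thesis using rv [OF iI]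
      by (simp add: prob_compl measurable_sets [OF rv [OF iI]])
  qed
  have "{\<omega> \<in> space M. \<forall>i\<in>S. s < X i \<omega>} = (\<Inter>i\<in>S. X i -` {s<..} \<inter> space M)"
    using S by auto
  also have "prob \<dots> = (\<Prod>i\<in>S. prob (X i -` {s<..} \<inter> space M))"
    using S by (intro indep_varsD [OF X]) auto
  finally show ?thesis using one by simp
qed

lemma prob_all_le:
  assumes X: "indep_vars (\<lambda>_. borel) X I" and S: "finite S" "S \<subseteq> I"
    and F: "\<And>i. i \<in> I \<Longrightarrow> cdf (distr M borel (X i)) = F"
  shows "prob {\<omega> \<in> space M. \<forall>i\<in>S. X i \<omega> \<le> b} = F b ^ card S"
proof (cases "S = {}")
  case True
  then show ?thesis by (simp add: prob_space)
next
  case False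
  have rv: "random_variable borel (X i)" if "i \<in> I" for i
    using X that by (auto simp: indep_vars_def)
  have one: "prob (X i -` {..b} \<inter> space M) = F b" if "i \<in> S" for i
    using F [of i] rv [of i] that S by (auto simp: cdf_def measure_distr)
  have "{\<omega> \<in> space M. \<forall>i\<in>S. X i \<omega> \<le> b} = (\<Inter>i\<in>S. X i -` {..b} \<inter> space M)"
    using False by auto
  also have "prob \<dots> = (\<Prod>i\<in>S. prob (X i -` {..b} \<inter> space M))"
    using S False by (intro indep_varsD [OF X]) auto
  finally show ?thesis using one by simp
qed

text \<open>The blocks \<open>B k\<close> and \<open>S\<close> are disjoint, so that the event on \<open>S\<close> and the failures of the
  attempts \<open>k < g\<close> are independent; an attempt succeeds when all of its at most \<open>N\<close> variables are
  at most \<open>b\<close>.\<close>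

lemma prob_greater_and_attempts_fail_le:
  fixes B :: "nat \<Rightarrow> 'i set"
  assumes X: "indep_vars (\<lambda>_. borel) X I" and S: "finite S" "S \<noteq> {}" "S \<subseteq> I"
    and F: "\<And>i. i \<in> I \<Longrightarrow> cdf (distr M borel (X i)) = F"
    and B: "\<And>k. finite (B k)" "\<And>k. B k \<subseteq> I" "\<And>k. card (B k) \<le> N"
    and disj: "disjoint_family B" "\<And>k. B k \<inter> S = {}"
  shows "prob {\<omega> \<in> space M. (\<forall>i\<in>S. s < X i \<omega>) \<and> (\<forall>k<g. \<exists>i\<in>B k. b < X i \<omega>)}
           \<le> (1 - F s) ^ card S * (1 - F b ^ N) ^ g"
proof -
  have rv [measurable]: "random_variable borel (X i)" if "i \<in> I" for i
    using X that by (auto simp: indep_vars_def)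
  obtain i0 where i0: "i0 \<in> I" using S by blast
  have Fb: "0 \<le> F b" "F b \<le> 1"
    using F [OF i0] rv [OF i0] by (auto simp: cdf_def measure_distr)
  define K where "K j = (case j of 0 \<Rightarrow> S | Suc k \<Rightarrow> B k)" for j
  have K: "finite (K j)" "K j \<subseteq> I" for j
    using B S by (auto simp: K_def split: nat.splits)
  have "disjoint_family_on K {..<Suc g}"
    using disj unfolding K_def disjoint_family_on_def by (auto split: nat.splits)
  with K have ind: "indep_vars (\<lambda>j. PiM (K j) (\<lambda>_. borel)) (\<lambda>j \<omega>. restrict (\<lambda>i. X i \<omega>) (K j)) {..<Suc g}"
    by (intro indep_vars_restrict [OF X]) auto
  define A where "A j = (case j of
      0 \<Rightarrow> {f \<in> space (PiM (K j) (\<lambda>_. borel :: real measure)). \<forall>i\<in>K j. s < f i}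
    | Suc k \<Rightarrow> {f \<in> space (PiM (K j) (\<lambda>_. borel)). \<exists>i\<in>K j. b < f i})" for j
  have A: "A j \<in> sets (PiM (K j) (\<lambda>_. borel))" for j
  proof (cases j)
    case 0
    show ?thesis unfolding A_def 0 using K(1) [of 0] by simp measurable
  next
    case (Suc k)
    show ?thesis unfolding A_def Suc using K(1) [of "Suc k"] by simp measurable
  qed
  let ?E = "\<lambda>j. (\<lambda>\<omega>. restrict (\<lambda>i. X i \<omega>) (K j)) -` A j \<inter> space M"
  have E0: "?E 0 = {\<omega> \<in> space M. \<forall>i\<in>S. s < X i \<omega>}"
    by (auto simp: A_def K_def space_PiM)
  have ES: "?E (Suc k) = {\<omega> \<in> space M. \<exists>i\<in>B k. b < X i \<omega>}" for k
    by (auto simp: A_def K_def space_PiM)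
  have fail: "prob (?E (Suc k)) \<le> 1 - F b ^ N" for k
  proof -
    have "?E (Suc k) = space M - {\<omega> \<in> space M. \<forall>i\<in>B k. X i \<omega> \<le> b}"
      unfolding ES by (auto simp: not_le)
    moreover have "{\<omega> \<in> space M. \<forall>i\<in>B k. X i \<omega> \<le> b} \<in> events"
    proof (rule sets.sets_Collect_finite_All)
      fix i assume "i \<in> B k"
      then have [measurable]: "random_variable borel (X i)" using B(2) rv by blast
      show "{\<omega> \<in> space M. X i \<omega> \<le> b} \<in> events" by measurable
    qed (rule B(1))
    ultimately have "prob (?E (Suc k)) = 1 - F b ^ card (B k)"
      using prob_all_le [OF X B(1,2) F] by (simp add: prob_compl)
    also have "\<dots> \<le> 1 - F b ^ N" using Fb B(3) by (simp add: power_decreasing)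
    finally show ?thesis .
  qed
  have "{\<omega> \<in> space M. (\<forall>i\<in>S. s < X i \<omega>) \<and> (\<forall>k<g. \<exists>i\<in>B k. b < X i \<omega>)} = (\<Inter>j\<in>{..<Suc g}. ?E j)"
  proof -
    have "(\<Inter>j\<in>{..<Suc g}. ?E j) = ?E 0 \<inter> (\<Inter>k\<in>{..<g}. ?E (Suc k))"
      unfolding lessThan_Suc_eq_insert_0 by (simp only: image_image INT_insert)
    also have "\<dots> = {\<omega> \<in> space M. (\<forall>i\<in>S. s < X i \<omega>) \<and> (\<forall>k<g. \<exists>i\<in>B k. b < X i \<omega>)}"
      unfolding E0 ES by auto
    finally show ?thesis by simp
  qed
  also have "prob \<dots> = (\<Prod>j\<in>{..<Suc g}. prob (?E j))"
    by (intro indep_varsD_finite [OF ind]) (auto intro: A)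
  also have "\<dots> = prob (?E 0) * (\<Prod>k<g. prob (?E (Suc k)))"
    by (rule prod.lessThan_Suc_shift)
  also have "\<dots> \<le> (1 - F s) ^ card S * (1 - F b ^ N) ^ g"
  proof (rule mult_mono)
    show "prob (?E 0) \<le> (1 - F s) ^ card S" unfolding E0 using prob_all_greater [OF X S F] by simp
    have "(\<Prod>k<g. prob (?E (Suc k))) \<le> (\<Prod>k<g. 1 - F b ^ N)"
      by (intro prod_mono conjI fail) simp
    then show "(\<Prod>k<g. prob (?E (Suc k))) \<le> (1 - F b ^ N) ^ g" by simp
    show "0 \<le> (1 - F s) ^ card S" using prob_all_greater [OF X S F, of s] measure_nonneg by metis
  qed (simp add: prod_nonneg)
  finally show ?thesis .
qed

text \<open>Counting the \<open>n \<ge> 1\<close> with \<open>c n < Y\<close> gives at most \<open>\<bar>Y\<bar> / c\<close>.\<close>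

lemma suminf_tail_le_expectation:
  assumes Y: "integrable M Y" and c: "0 < c"
  shows "(\<Sum>n. emeasure M {\<omega> \<in> space M. c * real (Suc n) < Y \<omega>}) \<le> ennreal (expectation (\<lambda>\<omega>. \<bar>Y \<omega>\<bar>) / c)"
proof -
  have [measurable]: "Y \<in> borel_measurable M" using Y by auto
  have "(\<Sum>n. emeasure M {\<omega> \<in> space M. c * real (Suc n) < Y \<omega>}) =
      (\<Sum>n. \<integral>\<^sup>+\<omega>. indicator {\<omega> \<in> space M. c * real (Suc n) < Y \<omega>} \<omega> \<partial>M)"
    by (intro suminf_cong) (subst nn_integral_indicator, auto)
  also have "\<dots> = (\<integral>\<^sup>+\<omega>. (\<Sum>n. indicator {\<omega> \<in> space M. c * real (Suc n) < Y \<omega>} \<omega>) \<partial>M)"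
    by (rule nn_integral_suminf [symmetric]) measurable
  also have "\<dots> \<le> (\<integral>\<^sup>+\<omega>. ennreal (\<bar>Y \<omega>\<bar> / c) \<partial>M)"
  proof (rule nn_integral_mono)
    fix \<omega> assume \<omega>: "\<omega> \<in> space M"
    have "(\<Sum>n<m. indicator {\<omega> \<in> space M. c * real (Suc n) < Y \<omega>} \<omega>) \<le> ennreal (\<bar>Y \<omega>\<bar> / c)" for m
    proof -
      have "(\<Sum>n<m. indicator {\<omega> \<in> space M. c * real (Suc n) < Y \<omega>} \<omega> :: real) \<le> \<bar>Y \<omega>\<bar> / c"
      proof (induction m)
        case 0
        then show ?case using c by simp
      next
        case (Suc m)
        show ?case
        proof (cases "c * real (Suc m) < Y \<omega>")
          case True
          have "(\<Sum>n<Suc m. indicator {\<omega> \<in> space M. c * real (Suc n) < Y \<omega>} \<omega> :: real) \<le> (\<Sum>n<Suc m. 1)"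
            by (intro sum_mono) (simp add: indicator_def)
          also have "\<dots> = real (Suc m)" by simp
          also have "\<dots> \<le> \<bar>Y \<omega>\<bar> / c" using True c by (simp add: field_simps)
          finally show ?thesis .
        next
          case False
          then show ?thesis using Suc by simp
        qed
      qed
      then have "ennreal (\<Sum>n<m. indicator {\<omega> \<in> space M. c * real (Suc n) < Y \<omega>} \<omega>) \<le> ennreal (\<bar>Y \<omega>\<bar> / c)"
        by (rule ennreal_leI)
      then show ?thesis by (simp add: sum_ennreal [symmetric] ennreal_indicator)
    qed
    then show "(\<Sum>n. indicator {\<omega> \<in> space M. c * real (Suc n) < Y \<omega>} \<omega>) \<le> ennreal (\<bar>Y \<omega>\<bar> / c)"
      by (intro suminf_le_const) auto
  qed
  also have "\<dots> = ennreal (expectation (\<lambda>\<omega>. \<bar>Y \<omega>\<bar> / c))"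
    using Y c by (intro nn_integral_eq_integral) auto
  finally show ?thesis by simp
qed

end

section \<open>Excess of the passage time\<close>

locale brochette = prob_space M for M :: "'w measure" +
  fixes \<tau> :: "(int ^ 'd::finite) set \<Rightarrow> 'w \<Rightarrow> real" and F :: "real \<Rightarrow> real"
  assumes indep: "indep_vars (\<lambda>_. borel) \<tau> integer_lines"
    and nonneg: "\<And>\<delta> \<omega>. \<delta> \<in> integer_lines \<Longrightarrow> \<omega> \<in> space M \<Longrightarrow> 0 \<le> \<tau> \<delta> \<omega>"
    and distr: "\<And>\<delta>. \<delta> \<in> integer_lines \<Longrightarrow> cdf (distr M borel (\<tau> \<delta>)) = F"
begin

abbreviation T :: "int ^ 'd \<Rightarrow> 'w \<Rightarrow> real" where
  "T z \<omega> \<equiv> passage_time (\<lambda>\<delta>. \<tau> \<delta> \<omega>) 0 z"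

lemma line_time_measurable: "\<delta> \<in> integer_lines \<Longrightarrow> \<tau> \<delta> \<in> borel_measurable M"
  using indep by (auto simp: indep_vars_def)

lemma path_time_measurable:
  "lattice_path x y vs \<Longrightarrow> (\<lambda>\<omega>. path_time (\<lambda>\<delta>. \<tau> \<delta> \<omega>) vs) \<in> borel_measurable M"
proof (induction vs arbitrary: x rule: induct_list012)
  case 1
  then show ?case by (simp add: lattice_path_def)
next
  case (2 v)
  then show ?case by simp
next
  case (3 v w vs)
  then have v: "{v, w} \<in> lattice_edges" "lattice_path w y (w # vs)" by auto
  show ?case
    using line_time_measurable [OF line_of_edge_in_integer_lines [OF v(1)]] "3.IH"(2) [OF v(2)]
    by simp
qed

lemma passage_time_measurable [measurable]: "T z \<in> borel_measurable M"
  unfolding passage_time_def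
proof (rule borel_measurable_cINF_real)
  show "countable (Collect (lattice_path 0 z))" by simp
qed (simp add: path_time_measurable)

lemma F_bounds: "0 \<le> F s" "F s \<le> 1"
proof -
  note \<delta> = line_through_in_integer_lines [of undefined undefined]
  have "F s = cdf (distr M borel (\<tau> (line_through undefined undefined))) s"
    using distr [OF \<delta>] by simp
  then show "0 \<le> F s" "F s \<le> 1"
    using line_time_measurable [OF \<delta>] by (auto simp: cdf_def measure_distr)
qed

text \<open>The summand with index \<open>g\<close> bounds the probability that the first \<open>g\<close> detours fail and that
  the cheapest line at one of the two ends is too slow for a detour at distance \<open>g + 1\<close>. The number
  of lines in a detour accounts for the exponent \<open>4 d\<close>.\<close>

definition excess_bound :: "real \<Rightarrow> real \<Rightarrow> ennreal" where
  "excess_bound b t = (\<Sum>g. ennreal (2 * (1 - F b ^ (CARD('d) * 4)) ^ g) *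
     ennreal ((1 - F (t / (2 * real (Suc g)) - 2 * b)) ^ CARD('d)))"

text \<open>The exceptional event collects, over all \<open>g\<close>, the failure of the first \<open>g\<close> detours together
  with a slow exit at \<open>u\<close> or \<open>v\<close>. Outside of it the first detour that succeeds is affordable: its
  two ends cost at most \<open>t / 2\<close> each by the choice of the threshold.\<close>

lemma coordinate_leg:
  fixes u :: "int ^ 'd"
  assumes dim: "CARD('d) \<ge> 2" and b: "0 < b"
  shows "\<exists>E\<in>events. emeasure M E \<le> excess_bound b t \<and>
    (\<forall>\<omega>\<in>space M - E. reachable_within (\<lambda>\<delta>. \<tau> \<delta> \<omega>) u (u + axis i c) (b * of_int \<bar>c\<bar> + t))"
proof -
  have "\<exists>j. j \<noteq> i"
  proof (rule ccontr)
    assume "\<nexists>j. j \<noteq> i"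
    then have "(UNIV :: 'd set) = {i}" by auto
    then have "CARD('d) = 1" by (metis card_1_singleton_iff One_nat_def)
    with dim show False by simp
  qed
  then obtain j where ij: "i \<noteq> j" by metis
  define s :: int where "s = (if 0 \<le> c then 1 else - 1)"
  define m where "m = nat \<bar>c\<bar>"
  define v where "v = u + axis i c"
  have s: "\<bar>s\<bar> = 1" and c: "c = s * int m" by (auto simp: s_def m_def)
  have v': "v = u + axis i (s * int m)" by (simp add: v_def c)
  define B where "B k = detour_lines s j u v (Suc k)" for k
  define S where "S w = range (\<lambda>k. line_through k w)" for w :: "int ^ 'd"
  define thr where "thr g = t / (2 * real (Suc g)) - 2 * b" for g
  define Ev where "Ev w g = {\<omega> \<in> space M. (\<forall>\<delta>\<in>S w. thr g < \<tau> \<delta> \<omega>) \<and>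
    (\<forall>k<g. \<exists>\<delta>\<in>B k. b < \<tau> \<delta> \<omega>)}" for w g
  define E where "E = (\<Union>g. Ev u g \<union> Ev v g)"
  let ?q = "1 - F b ^ (CARD('d) * 4)"
  have S: "finite (S w)" "S w \<noteq> {}" "S w \<subseteq> integer_lines" "card (S w) = CARD('d)" for w
    unfolding S_def by (auto intro!: card_image injI dest: line_through_eqD(1))
  have B: "finite (B k)" "B k \<subseteq> integer_lines" "card (B k) \<le> CARD('d) * 4" for k
    unfolding B_def by (rule finite_detour_lines detour_lines_subset card_detour_lines_le)+
  have disj: "disjoint_family B" "B k \<inter> S u = {}" "B k \<inter> S v = {}" for k
    using detour_lines_disjoint [OF s ij v'] lines_through_notin_detour_lines [OF s ij v', of "Suc k"]
    unfolding disjoint_family_on_def B_def S_def by auto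
  have Ev_meas: "Ev w g \<in> events" for w g
  proof -
    have gt: "{\<omega> \<in> space M. r < \<tau> \<delta> \<omega>} \<in> events" if "\<delta> \<in> integer_lines" for \<delta> r
    proof -
      have [measurable]: "\<tau> \<delta> \<in> borel_measurable M" by (rule line_time_measurable [OF that])
      show ?thesis by measurable
    qed
    show ?thesis unfolding Ev_def
      using S B by (intro sets.sets_Collect_conj sets.sets_Collect_finite_All
          sets.sets_Collect_finite_Ex sets.sets_Collect_countable_All
          sets.sets_Collect_imp sets.sets_Collect_const gt)
        (auto dest: subsetD [OF S(3)] subsetD [OF B(2)])
  qed
  have q: "0 \<le> ?q" using F_bounds by (simp add: power_le_one)
  have Ev: "emeasure M (Ev w g) \<le> ennreal (?q ^ g) * ennreal ((1 - F (thr g)) ^ CARD('d))"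
    if "w = u \<or> w = v" for w g
  proof -
    have "prob (Ev w g) \<le> (1 - F (thr g)) ^ card (S w) * ?q ^ g"
      unfolding Ev_def
      by (rule prob_greater_and_attempts_fail_le [OF indep S(1-3) distr B disj(1)])
        (use disj that in auto)
    then have "ennreal (prob (Ev w g)) \<le> ennreal (?q ^ g * (1 - F (thr g)) ^ CARD('d))"
      by (intro ennreal_leI) (simp add: S mult.commute)
    then show ?thesis using q F_bounds by (simp add: emeasure_eq_measure ennreal_mult)
  qed
  show ?thesis
  proof (intro bexI conjI ballI)
    show "E \<in> events" unfolding E_def using Ev_meas by auto
    have "emeasure M E \<le> (\<Sum>g. emeasure M (Ev u g \<union> Ev v g))"
      unfolding E_def using Ev_meas by (intro emeasure_subadditive_countably) auto
    also have "\<dots> \<le> (\<Sum>g. ennreal (2 * ?q ^ g) * ennreal ((1 - F (thr g)) ^ CARD('d)))"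
    proof (intro suminf_le)
      fix g
      have "emeasure M (Ev u g \<union> Ev v g) \<le> emeasure M (Ev u g) + emeasure M (Ev v g)"
        using Ev_meas by (intro emeasure_subadditive) auto
      also have "\<dots> \<le> 2 * (ennreal (?q ^ g) * ennreal ((1 - F (thr g)) ^ CARD('d)))"
        using Ev [of u g] Ev [of v g] by (auto simp: mult_2 intro: add_mono)
      also have "\<dots> = ennreal (2 * ?q ^ g) * ennreal ((1 - F (thr g)) ^ CARD('d))"
        using q by (simp add: ennreal_mult mult.assoc)
      finally show "emeasure M (Ev u g \<union> Ev v g) \<le>
        ennreal (2 * ?q ^ g) * ennreal ((1 - F (thr g)) ^ CARD('d))" .
    qed auto
    also have "\<dots> = excess_bound b t" unfolding excess_bound_def thr_def ..
    finally show "emeasure M E \<le> excess_bound b t" .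
  next
    fix \<omega> assume \<omega>: "\<omega> \<in> space M - E"
    have nonneg': "\<And>\<delta>. \<delta> \<in> integer_lines \<Longrightarrow> 0 \<le> \<tau> \<delta> \<omega>" using nonneg \<omega> by auto
    have "\<exists>k. \<forall>\<delta>\<in>B k. \<tau> \<delta> \<omega> \<le> b"
    proof (rule ccontr)
      assume "\<not> ?thesis"
      then have fail: "\<forall>k. \<exists>\<delta>\<in>B k. b < \<tau> \<delta> \<omega>" by (metis not_le)
      obtain g where g: "t / (4 * b) < real g" using reals_Archimedean2 by blast
      \<comment> \<open>For this \<open>g\<close> the threshold is negative, hence exceeded by every line.\<close>
      have "t < 4 * b * real g" using g b by (simp add: field_simps)
      also have "\<dots> \<le> 4 * b * real (Suc g)" using b by (intro mult_left_mono) auto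
      finally have "thr g < 0" unfolding thr_def by (simp add: field_simps)
      then have "\<omega> \<in> Ev u g"
        using fail \<omega> nonneg' S(3) unfolding Ev_def by fastforce
      with \<omega> show False unfolding E_def by blast
    qed
    then obtain g where g: "\<forall>\<delta>\<in>B g. \<tau> \<delta> \<omega> \<le> b" "\<forall>k<g. \<exists>\<delta>\<in>B k. b < \<tau> \<delta> \<omega>"
      using exists_least_iff [of "\<lambda>k. \<forall>\<delta>\<in>B k. \<tau> \<delta> \<omega> \<le> b"] by (auto simp: not_le)
    have "\<omega> \<notin> Ev u g" "\<omega> \<notin> Ev v g" using \<omega> unfolding E_def by auto
    with g(2) \<omega> obtain k l where kl: "\<tau> (line_through k u) \<omega> \<le> thr g" "\<tau> (line_through l v) \<omega> \<le> thr g"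
      unfolding Ev_def S_def by (auto simp: not_less)
    have "reachable_within (\<lambda>\<delta>. \<tau> \<delta> \<omega>) u v
        (b * real m + 2 * (real (Suc g) * (thr g + 2 * b)))"
      by (rule reachable_within_detour [OF nonneg' s ij v' _ _ kl])
        (use g(1) b in \<open>auto simp: B_def\<close>)
    moreover have "2 * (real (Suc g) * (thr g + 2 * b)) = t" by (simp add: thr_def field_simps)
    moreover have "real m = of_int \<bar>c\<bar>" by (simp add: m_def)
    ultimately show "reachable_within (\<lambda>\<delta>. \<tau> \<delta> \<omega>) u (u + axis i c) (b * of_int \<bar>c\<bar> + t)"
      by (simp add: v_def)
  qed
qed

lemma norm1_restrict_coords_insert:
  assumes "i \<notin> S"
  shows "norm1 (restrict_coords (insert i S) z) = norm1 (restrict_coords S z) + \<bar>z $ i\<bar>"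
proof -
  have "norm1 (restrict_coords S z) = (\<Sum>k\<in>S. \<bar>z $ k\<bar>)" for S
    unfolding norm1_def restrict_coords_def by (intro sum.mono_neutral_cong_right) auto
  then show ?thesis using assms by simp
qed

text \<open>Each of the \<open>d\<close> coordinate legs may contribute an excess \<open>t\<close>. The same bound serves for all
  endpoints \<open>z\<close>.\<close>

lemma emeasure_excess_le:
  assumes dim: "CARD('d) \<ge> 2" and b: "0 < b"
  shows "emeasure M {\<omega> \<in> space M. b * of_int (norm1 z) + real CARD('d) * t < T z \<omega>}
           \<le> of_nat CARD('d) * excess_bound b t"
proof -
  have "\<exists>E\<in>events. emeasure M E \<le> of_nat (card S) * excess_bound b t \<and>
    (\<forall>\<omega>\<in>space M - E. reachable_within (\<lambda>\<delta>. \<tau> \<delta> \<omega>) 0 (restrict_coords S z)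
      (b * of_int (norm1 (restrict_coords S z)) + real (card S) * t))" for S
    using finite [of S]
  proof (induction S rule: finite_induct)
    case empty
    show ?case
      by (intro bexI [of _ "{}"]) (auto simp: norm1_def intro!: reachable_within_refl)
  next
    case (insert i S)
    then obtain E where E: "E \<in> events" "emeasure M E \<le> of_nat (card S) * excess_bound b t"
      "\<And>\<omega>. \<omega> \<in> space M - E \<Longrightarrow> reachable_within (\<lambda>\<delta>. \<tau> \<delta> \<omega>) 0 (restrict_coords S z)
        (b * of_int (norm1 (restrict_coords S z)) + real (card S) * t)" by blast
    obtain E' where E': "E' \<in> events" "emeasure M E' \<le> excess_bound b t"
      "\<And>\<omega>. \<omega> \<in> space M - E' \<Longrightarrow> reachable_within (\<lambda>\<delta>. \<tau> \<delta> \<omega>) (restrict_coords S z)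
        (restrict_coords S z + axis i (z $ i)) (b * of_int \<bar>z $ i\<bar> + t)"
      using coordinate_leg [OF dim b, of t "restrict_coords S z" i "z $ i"] by blast
    show ?case
    proof (intro bexI conjI ballI)
      show "E \<union> E' \<in> events" using E E' by auto
      have "emeasure M (E \<union> E') \<le> emeasure M E + emeasure M E'"
        using E E' by (intro emeasure_subadditive) auto
      also have "\<dots> \<le> of_nat (card S) * excess_bound b t + excess_bound b t"
        by (intro add_mono E E')
      also have "\<dots> = of_nat (card (insert i S)) * excess_bound b t"
        using insert.hyps by (simp add: algebra_simps)
      finally show "emeasure M (E \<union> E') \<le> of_nat (card (insert i S)) * excess_bound b t" .
      fix \<omega> assume "\<omega> \<in> space M - (E \<union> E')"
      then have "reachable_within (\<lambda>\<delta>. \<tau> \<delta> \<omega>) 0 (restrict_coords (insert i S) z)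
        ((b * of_int (norm1 (restrict_coords S z)) + real (card S) * t) + (b * of_int \<bar>z $ i\<bar> + t))"
        unfolding restrict_coords_insert [OF insert.hyps(2)]
        by (intro reachable_within_trans [OF E(3) E'(3)]) auto
      moreover have "(b * of_int (norm1 (restrict_coords S z)) + real (card S) * t) + (b * of_int \<bar>z $ i\<bar> + t)
        = b * of_int (norm1 (restrict_coords (insert i S) z)) + real (card (insert i S)) * t"
        using insert.hyps by (simp add: norm1_restrict_coords_insert algebra_simps)
      ultimately show "reachable_within (\<lambda>\<delta>. \<tau> \<delta> \<omega>) 0 (restrict_coords (insert i S) z)
        (b * of_int (norm1 (restrict_coords (insert i S) z)) + real (card (insert i S)) * t)" by simp
    qed
  qed
  from this [of UNIV] obtain E where E: "E \<in> events"
    "emeasure M E \<le> of_nat CARD('d) * excess_bound b t"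
    "\<And>\<omega>. \<omega> \<in> space M - E \<Longrightarrow> reachable_within (\<lambda>\<delta>. \<tau> \<delta> \<omega>) 0 z
      (b * of_int (norm1 z) + real CARD('d) * t)" by auto
  have "T z \<omega> \<le> b * of_int (norm1 z) + real CARD('d) * t" if "\<omega> \<in> space M - E" for \<omega>
    using that nonneg by (intro passage_time_le E(3)) auto
  then have "{\<omega> \<in> space M. b * of_int (norm1 z) + real CARD('d) * t < T z \<omega>} \<subseteq> E"
    by (force simp: not_less [symmetric])
  with E(1,2) show ?thesis by (meson emeasure_mono order_trans)
qed

text \<open>Under first moment tails of the minimum, the tail of the product of a geometric number of
  attempts and the minimum is again summable, since \<open>\<Sum>g. (g + 1) q\<^sup>g\<close> converges.\<close>

lemma suminf_excess_bound_finite: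
  assumes Fb: "0 < F b"
    and tail: "\<And>c. 0 < c \<Longrightarrow>
      (\<Sum>n. ennreal ((1 - F (c * real (Suc n) - 2 * b)) ^ CARD('d))) \<le> ennreal (K / c)"
    and K: "0 \<le> K" and c: "0 < c"
  shows "(\<Sum>n. excess_bound b (c * real (Suc n))) < top"
proof -
  define q where "q = 1 - F b ^ (CARD('d) * 4)"
  have q: "0 \<le> q" "q < 1" using F_bounds Fb by (auto simp: q_def power_le_one)
  let ?f = "\<lambda>g n. ennreal ((1 - F (c / (2 * real (Suc g)) * real (Suc n) - 2 * b)) ^ CARD('d))"
  have "(\<Sum>n. excess_bound b (c * real (Suc n))) = (\<Sum>n. \<Sum>g. ennreal (2 * q ^ g) * ?f g n)"
    unfolding excess_bound_def q_def by simp
  also have "\<dots> = (\<Sum>g. \<Sum>n. ennreal (2 * q ^ g) * ?f g n)"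
    using nn_integral_suminf [of "\<lambda>g n. ennreal (2 * q ^ g) * ?f g n" "count_space UNIV"]
    by (simp add: nn_integral_count_space_nat)
  also have "\<dots> = (\<Sum>g. ennreal (2 * q ^ g) * (\<Sum>n. ?f g n))"
    by simp
  also have "\<dots> \<le> (\<Sum>g. ennreal (4 * K / c * (real (Suc g) * q ^ g)))"
  proof (intro suminf_le)
    fix g
    have "ennreal (2 * q ^ g) * (\<Sum>n. ?f g n) \<le> ennreal (2 * q ^ g) * ennreal (K / (c / (2 * real (Suc g))))"
      using c by (intro mult_left_mono tail) auto
    also have "\<dots> = ennreal (2 * q ^ g * (K / (c / (2 * real (Suc g)))))"
      using q K c by (intro ennreal_mult [symmetric]) auto
    also have "2 * q ^ g * (K / (c / (2 * real (Suc g)))) = 4 * K / c * (real (Suc g) * q ^ g)"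
      using c by (simp add: field_simps)
    finally show "ennreal (2 * q ^ g) * (\<Sum>n. ?f g n) \<le> ennreal (4 * K / c * (real (Suc g) * q ^ g))" .
  qed auto
  also have "\<dots> < top"
  proof -
    have "summable (\<lambda>g. 4 * K / c * (real (Suc g) * q ^ g))"
      using geometric_deriv_sums [of q] q by (intro summable_mult) (auto simp: sums_iff)
    then show ?thesis using q K c by (subst suminf_ennreal2) auto
  qed
  finally show ?thesis .
qed

end

section \<open>The time constant\<close>

lemma norm1_scale: "norm1 (int n *s x) = int n * norm1 x"
  by (simp add: norm1_def abs_mult sum_distrib_left)

lemma norm1_nonneg: "0 \<le> norm1 x"
  by (simp add: norm1_def sum_nonneg)

context brochette
begin

lemma AE_eventually_passage_time_le:
  fixes x :: "int ^ 'd"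
  assumes dim: "CARD('d) \<ge> 2" and b: "0 < b" and e: "0 < e"
    and fin: "\<And>c. 0 < c \<Longrightarrow> (\<Sum>n. excess_bound b (c * real (Suc n))) < top"
  shows "AE \<omega> in M. \<forall>\<^sub>F n in sequentially.
    T (int n *s x) \<omega> / real n \<le> b * of_int (norm1 x) + e"
proof -
  define c where "c = e / real CARD('d)"
  have c: "0 < c" using e by (simp add: c_def)
  define A where "A n = {\<omega> \<in> space M. b * of_int (norm1 (int (Suc n) *s x)) +
    real CARD('d) * (c * real (Suc n)) < T (int (Suc n) *s x) \<omega>}" for n
  have meas: "A n \<in> events" for n unfolding A_def by measurable
  have "(\<Sum>n. emeasure M (A n)) \<le> (\<Sum>n. of_nat CARD('d) * excess_bound b (c * real (Suc n)))"
    unfolding A_def by (intro suminf_le emeasure_excess_le dim b) auto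
  also have "\<dots> < top" using fin [OF c] by (simp add: ennreal_mult_less_top of_nat_less_top)
  finally have "summable (\<lambda>n. measure M (A n))"
    by (intro summable_suminf_not_top) (auto simp: emeasure_eq_measure)
  then have "AE \<omega> in M. \<forall>\<^sub>F n in sequentially. \<omega> \<in> space M - A n"
    using meas by (intro borel_cantelli_AE1) (auto simp: emeasure_eq_measure)
  then show ?thesis
  proof (rule AE_mp, intro AE_I2 impI)
    fix \<omega> assume \<omega>: "\<omega> \<in> space M" "\<forall>\<^sub>F n in sequentially. \<omega> \<in> space M - A n"
    have "\<forall>\<^sub>F n in sequentially.
      T (int (Suc n) *s x) \<omega> / real (Suc n) \<le> b * of_int (norm1 x) + e"
      using \<omega>(2)
    proof eventually_elim
      case (elim n)
      then have "T (int (Suc n) *s x) \<omega> \<le> b * of_int (norm1 (int (Suc n) *s x)) +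
        real CARD('d) * (c * real (Suc n))" unfolding A_def by auto
      also have "\<dots> = (b * of_int (norm1 x) + e) * real (Suc n)"
        unfolding norm1_scale by (simp add: c_def field_simps)
      finally show ?case by (simp add: pos_divide_le_eq)
    qed
    then show "\<forall>\<^sub>F n in sequentially. T (int n *s x) \<omega> / real n \<le> b * of_int (norm1 x) + e"
      by (subst (asm) eventually_sequentially_Suc
        [of "\<lambda>n. T (int n *s x) \<omega> / real n \<le> b * of_int (norm1 x) + e"])
  qed
qed

lemma ennreal_le_suminf_steps:
  fixes y d :: real
  assumes d: "0 < d"
  shows "ennreal y \<le> (\<Sum>k. ennreal d * indicator {y. d * real k < y} y)"
proof -
  define m where "m = nat \<lceil>y / d\<rceil>"
  have below: "d * real k < y" if "k < m" for k
  proof -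
    have "real k < y / d" using that unfolding m_def by linarith
    then show ?thesis using d by (simp add: field_simps)
  qed
  have "y / d \<le> real m" unfolding m_def by linarith
  then have "y \<le> real m * d" using d by (simp add: field_simps)
  then have "ennreal y \<le> ennreal (real m * d)" by (rule ennreal_leI)
  also have "\<dots> = (\<Sum>k<m. ennreal d * indicator {y. d * real k < y} y)"
    using below d by (simp add: ennreal_mult ennreal_of_nat_eq_real_of_nat)
  also have "\<dots> \<le> (\<Sum>k. ennreal d * indicator {y. d * real k < y} y)"
    by (rule sum_le_suminf) auto
  finally show ?thesis .
qed

text \<open>The excess is summed in layers of thickness \<open>d\<close>, so that the layers fit the multiples of \<open>d\<close>
  in the tail bound.\<close>

lemma expected_excess_bounded:
  assumes dim: "CARD('d) \<ge> 2" and b: "0 < b"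
    and fin: "\<And>c. 0 < c \<Longrightarrow> (\<Sum>n. excess_bound b (c * real (Suc n))) < top"
  obtains C where "0 \<le> C"
    "\<And>z :: int ^ 'd. (\<integral>\<^sup>+\<omega>. ennreal (T z \<omega> - b * of_int (norm1 z)) \<partial>M) \<le> ennreal C"
proof -
  let ?d = "real CARD('d)"
  define D where "D = ennreal ?d * (1 + of_nat CARD('d) * (\<Sum>k. excess_bound b (1 * real (Suc k))))"
  have "D < top" using fin [of 1] unfolding D_def by (simp add: ennreal_mult_less_top of_nat_less_top)
  then obtain C where C: "0 \<le> C" "D = ennreal C" by (cases D) auto
  moreover have "(\<integral>\<^sup>+\<omega>. ennreal (T z \<omega> - b * of_int (norm1 z)) \<partial>M) \<le> D" for z
  proof -
    define A where "A k = {\<omega> \<in> space M. b * of_int (norm1 z) + ?d * real k < T z \<omega>}" for k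
    have A [measurable]: "A k \<in> events" for k unfolding A_def by measurable
    have "(\<integral>\<^sup>+\<omega>. ennreal (T z \<omega> - b * of_int (norm1 z)) \<partial>M) \<le>
        (\<integral>\<^sup>+\<omega>. (\<Sum>k. ennreal ?d * indicator (A k) \<omega>) \<partial>M)"
    proof (rule nn_integral_mono)
      fix \<omega> assume \<omega>: "\<omega> \<in> space M"
      have "indicator {y. ?d * real k < y} (T z \<omega> - b * of_int (norm1 z)) = (indicator (A k) \<omega> :: ennreal)"
        for k using \<omega> by (auto simp: A_def indicator_def algebra_simps)
      then show "ennreal (T z \<omega> - b * of_int (norm1 z)) \<le> (\<Sum>k. ennreal ?d * indicator (A k) \<omega>)"
        using ennreal_le_suminf_steps [of ?d "T z \<omega> - b * of_int (norm1 z)"] by simp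
    qed
    also have "\<dots> = (\<Sum>k. ennreal ?d * emeasure M (A k))"
      by (subst nn_integral_suminf) (auto simp: nn_integral_cmult_indicator)
    also have "\<dots> = ennreal ?d * (\<Sum>k. emeasure M (A k))" by simp
    also have "(\<Sum>k. emeasure M (A k)) = emeasure M (A 0) + (\<Sum>k. emeasure M (A (Suc k)))"
      using suminf_offset [of "\<lambda>k. emeasure M (A k)" 1] by simp
    also have "\<dots> \<le> 1 + (\<Sum>k. of_nat CARD('d) * excess_bound b (1 * real (Suc k)))"
    proof (intro add_mono suminf_le)
      show "emeasure M (A 0) \<le> 1" by (rule emeasure_le_1)
      show "emeasure M (A (Suc k)) \<le> of_nat CARD('d) * excess_bound b (1 * real (Suc k))" for k
        using emeasure_excess_le [OF dim b, of z "real (Suc k)"] by (simp add: A_def)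
    qed auto
    finally show ?thesis unfolding D_def by (simp add: mult_left_mono)
  qed
  ultimately show thesis using that by auto
qed

lemma AE_line_time_ge:
  assumes "\<And>\<eta>. 0 < \<eta> \<Longrightarrow> F (a - \<eta>) = 0"
  shows "AE \<omega> in M. \<forall>\<delta>\<in>integer_lines. a \<le> \<tau> \<delta> \<omega>"
proof (subst AE_ball_countable [OF countable_integer_lines], intro ballI)
  fix \<delta> :: "(int ^ 'd) set" assume \<delta>: "\<delta> \<in> integer_lines"
  have [measurable]: "\<tau> \<delta> \<in> borel_measurable M" by (rule line_time_measurable [OF \<delta>])
  have "AE \<omega> in M. a - 1 / real (Suc n) < \<tau> \<delta> \<omega>" for n
  proof (rule AE_I)
    have "prob {\<omega> \<in> space M. \<tau> \<delta> \<omega> \<le> a - 1 / real (Suc n)} = cdf (distr M borel (\<tau> \<delta>)) (a - 1 / real (Suc n))"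
      unfolding cdf_def by (subst measure_distr) (auto intro!: arg_cong [where f = prob])
    also have "\<dots> = 0" using assms distr [OF \<delta>] by simp
    finally show "emeasure M {\<omega> \<in> space M. \<tau> \<delta> \<omega> \<le> a - 1 / real (Suc n)} = 0"
      by (simp add: emeasure_eq_measure)
    show "{\<omega> \<in> space M. \<not> a - 1 / real (Suc n) < \<tau> \<delta> \<omega>} \<subseteq> {\<omega> \<in> space M. \<tau> \<delta> \<omega> \<le> a - 1 / real (Suc n)}"
      by auto
  qed measurable
  then have "AE \<omega> in M. \<forall>n. a - 1 / real (Suc n) < \<tau> \<delta> \<omega>" by (simp add: AE_all_countable)
  then show "AE \<omega> in M. a \<le> \<tau> \<delta> \<omega>"
  proof (rule AE_mp, intro AE_I2 impI)
    fix \<omega> assume *: "\<forall>n. a - 1 / real (Suc n) < \<tau> \<delta> \<omega>"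
    have "(\<lambda>n. a - 1 / real (Suc n)) \<longlonglongrightarrow> a - 0"
      using lim_inverse_n' by (intro tendsto_diff tendsto_const LIMSEQ_Suc)
    then show "a \<le> \<tau> \<delta> \<omega>"
      using * by (intro LIMSEQ_le_const2 [of _ a]) (auto intro: less_imp_le)
  qed
qed

theorem time_constant:
  fixes x :: "int ^ 'd"
  assumes dim: "CARD('d) \<ge> 2" and a: "0 \<le> a"
    and Fpos: "\<And>\<eta>. 0 < \<eta> \<Longrightarrow> 0 < F (a + \<eta>)" and Fzero: "\<And>\<eta>. 0 < \<eta> \<Longrightarrow> F (a - \<eta>) = 0"
    and fin: "\<And>b c. 0 < b \<Longrightarrow> 0 < F b \<Longrightarrow> 0 < c \<Longrightarrow> (\<Sum>n. excess_bound b (c * real (Suc n))) < top"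
  shows "AE \<omega> in M. (\<lambda>n. T (int n *s x) \<omega> / real n) \<longlonglongrightarrow> a * of_int (norm1 x)"
    and "integrable M (\<lambda>\<omega>. T (int n *s x) \<omega> / real n)"
    and "(\<lambda>n. LINT \<omega>|M. \<bar>T (int n *s x) \<omega> / real n - a * of_int (norm1 x)\<bar>) \<longlonglongrightarrow> 0"
proof -
  let ?X = "real_of_int (norm1 x)"
  have X: "0 \<le> ?X" using norm1_nonneg [of x] by simp
  have T0: "0 \<le> T z \<omega>" if "\<omega> \<in> space M" for z \<omega>
    using passage_time_ge_norm1 [of 0 "\<lambda>\<delta>. \<tau> \<delta> \<omega>" z] nonneg that by simp
  have "AE \<omega> in M. \<forall>\<delta>\<in>integer_lines. a \<le> \<tau> \<delta> \<omega>"
    by (rule AE_line_time_ge) (rule Fzero)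
  then have lower: "AE \<omega> in M. \<forall>n>0. a * ?X \<le> T (int n *s x) \<omega> / real n"
  proof (rule AE_mp, intro AE_I2 impI allI)
    fix \<omega> n assume l: "\<forall>\<delta>\<in>integer_lines. a \<le> \<tau> \<delta> \<omega>" and n: "0 < (n :: nat)"
    have "a * of_int (norm1 (int n *s x)) \<le> T (int n *s x) \<omega>"
      using l a by (intro passage_time_ge_norm1) auto
    then show "a * ?X \<le> T (int n *s x) \<omega> / real n"
      using n by (simp add: norm1_scale field_simps)
  qed
  have "AE \<omega> in M. \<forall>k. \<forall>\<^sub>F n in sequentially. T (int n *s x) \<omega> / real n
      \<le> (a + 1 / real (Suc k)) * ?X + 1 / real (Suc k)"
    unfolding AE_all_countable
    using a Fpos by (intro allI AE_eventually_passage_time_le dim fin) (auto intro: add_nonneg_pos)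
  then show "AE \<omega> in M. (\<lambda>n. T (int n *s x) \<omega> / real n) \<longlonglongrightarrow> a * ?X"
    using lower
  proof eventually_elim
    case (elim \<omega>)
    show ?case
    proof (rule tendstoI)
      fix e :: real assume e: "0 < e"
      obtain k :: nat where k: "(?X + 1) / e < real k" using reals_Archimedean2 by blast
      have "(?X + 1) < real k * e" using k e by (simp add: field_simps)
      also have "\<dots> \<le> real (Suc k) * e" using e by (intro mult_right_mono) auto
      finally have "(?X + 1) / real (Suc k) < e" by (simp add: field_simps)
      then have k: "(a + 1 / real (Suc k)) * ?X + 1 / real (Suc k) < a * ?X + e"
        by (simp add: algebra_simps add_divide_distrib)
      have "\<forall>\<^sub>F n in sequentially. 0 < n \<and> T (int n *s x) \<omega> / real n
          \<le> (a + 1 / real (Suc k)) * ?X + 1 / real (Suc k)"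
        using elim(1) by (intro eventually_conj eventually_gt_at_top) auto
      then show "\<forall>\<^sub>F n in sequentially. dist (T (int n *s x) \<omega> / real n) (a * ?X) < e"
      proof eventually_elim
        case (elim n)
        with \<open>\<forall>n>0. a * ?X \<le> T (int n *s x) \<omega> / real n\<close> k show ?case
          unfolding dist_real_def by fastforce
      qed
    qed
  qed
  have excess: "\<exists>C\<ge>0. \<forall>z. (\<integral>\<^sup>+\<omega>. ennreal (T z \<omega> - (a + e) * of_int (norm1 z)) \<partial>M) \<le> ennreal C"
    if "0 < e" for e
  proof -
    have b: "0 < a + e" using a that by simp
    show ?thesis using expected_excess_bounded [OF dim b fin [OF b Fpos [OF that]]] by metis
  qed
  have integrable_T: "integrable M (T z)" for z
  proof (rule integrableI_nonneg)
    obtain C where C: "(\<integral>\<^sup>+\<omega>. ennreal (T z \<omega> - (a + 1) * of_int (norm1 z)) \<partial>M) \<le> ennreal C"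
      using excess [of 1] by auto
    have "(\<integral>\<^sup>+\<omega>. ennreal (T z \<omega>) \<partial>M) \<le>
        (\<integral>\<^sup>+\<omega>. ennreal (T z \<omega> - (a + 1) * of_int (norm1 z)) + ennreal ((a + 1) * of_int (norm1 z)) \<partial>M)"
    proof (rule nn_integral_mono)
      fix \<omega>
      show "ennreal (T z \<omega>) \<le> ennreal (T z \<omega> - (a + 1) * of_int (norm1 z)) + ennreal ((a + 1) * of_int (norm1 z))"
      proof (cases "T z \<omega> \<le> (a + 1) * of_int (norm1 z)")
        case True
        then show ?thesis by (intro order_trans [OF ennreal_leI [OF True]]) simp
      next
        case False
        then show ?thesis using a norm1_nonneg [of z] by (simp add: ennreal_plus [symmetric] del: ennreal_plus)
      qed
    qed
    also have "\<dots> = (\<integral>\<^sup>+\<omega>. ennreal (T z \<omega> - (a + 1) * of_int (norm1 z)) \<partial>M) + ennreal ((a + 1) * of_int (norm1 z))"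
      by (subst nn_integral_add) (auto simp: emeasure_space_1)
    also have "\<dots> < \<infinity>" using C by (auto simp: ennreal_add_less_top intro: le_less_trans)
    finally show "(\<integral>\<^sup>+\<omega>. ennreal (T z \<omega>) \<partial>M) < \<infinity>" .
  qed (auto intro: T0)
  then show "integrable M (\<lambda>\<omega>. T (int n *s x) \<omega> / real n)" by simp
  let ?L = "\<lambda>n. LINT \<omega>|M. \<bar>T (int n *s x) \<omega> / real n - a * ?X\<bar>"
  \<comment> \<open>Almost surely there is no negative part, so the expected excess controls the whole
    \<open>L\<^sup>1\<close> distance.\<close>
  have L1: "\<exists>C. \<forall>n>0. ?L n \<le> e * ?X + C / real n" if e: "0 < e" for e
  proof -
    obtain C where C: "0 \<le> C"
      "\<And>z. (\<integral>\<^sup>+\<omega>. ennreal (T z \<omega> - (a + e) * of_int (norm1 z)) \<partial>M) \<le> ennreal C"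
      using excess [OF e] by auto
    have "?L n \<le> e * ?X + C / real n" if n: "0 < n" for n
    proof -
      let ?z = "int n *s x"
      let ?V = "\<lambda>\<omega>. max 0 (T ?z \<omega> - (a + e) * of_int (norm1 ?z))"
      have V: "integrable M ?V" using integrable_T by auto
      have "ennreal (LINT \<omega>|M. ?V \<omega>) = (\<integral>\<^sup>+\<omega>. ennreal (?V \<omega>) \<partial>M)"
        using V by (intro nn_integral_eq_integral [symmetric]) auto
      also have "\<dots> = (\<integral>\<^sup>+\<omega>. ennreal (T ?z \<omega> - (a + e) * of_int (norm1 ?z)) \<partial>M)"
        by (intro nn_integral_cong) (simp add: max_def ennreal_neg)
      also have "\<dots> \<le> ennreal C" by (rule C(2))
      finally have VC: "(LINT \<omega>|M. ?V \<omega>) \<le> C" using C(1) by simp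
      have "?L n \<le> (LINT \<omega>|M. e * ?X + ?V \<omega> / real n)"
      proof (rule integral_mono_AE)
        show "integrable M (\<lambda>\<omega>. \<bar>T ?z \<omega> / real n - a * ?X\<bar>)"
          "integrable M (\<lambda>\<omega>. e * ?X + ?V \<omega> / real n)"
          using integrable_T V by auto
        show "AE \<omega> in M. \<bar>T ?z \<omega> / real n - a * ?X\<bar> \<le> e * ?X + ?V \<omega> / real n"
          using lower
        proof eventually_elim
          case (elim \<omega>)
          have "T ?z \<omega> \<le> (a + e) * (real n * ?X) + ?V \<omega>" by (simp add: norm1_scale)
          then have "T ?z \<omega> / real n \<le> (a + e) * ?X + ?V \<omega> / real n"
            using n by (simp add: field_simps)
          with elim n show ?case by (auto simp: algebra_simps)
        qed
      qed
      also have "\<dots> = e * ?X + (LINT \<omega>|M. ?V \<omega>) / real n"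
        using V by (simp add: prob_space)
      also have "\<dots> \<le> e * ?X + C / real n" using VC by (simp add: divide_right_mono)
      finally show ?thesis .
    qed
    then show ?thesis by blast
  qed
  show "?L \<longlonglongrightarrow> 0"
  proof (rule tendstoI)
    fix r :: real assume r: "0 < r"
    define e where "e = r / (2 * (?X + 1))"
    have e: "0 < e" "e * ?X \<le> r / 2"
      using r X by (auto simp: e_def field_simps)
    obtain C where C: "\<And>n. 0 < n \<Longrightarrow> ?L n \<le> e * ?X + C / real n" using L1 [OF e(1)] by blast
    have "(\<lambda>n. C / real n) \<longlonglongrightarrow> 0" by (rule lim_const_over_n)
    then have "\<forall>\<^sub>F n in sequentially. C / real n < r / 2"
      using r by (intro order_tendstoD(2)) auto
    then have "\<forall>\<^sub>F n in sequentially. 0 < n \<and> C / real n < r / 2"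
      by (intro eventually_conj eventually_gt_at_top)
    then show "\<forall>\<^sub>F n in sequentially. dist (?L n) 0 < r"
    proof eventually_elim
      case (elim n)
      moreover have "0 \<le> ?L n" by simp
      ultimately show ?case using C [of n] e(2) unfolding dist_real_def by linarith
    qed
  qed
qed

end

theorem theorem1p5:
  fixes M :: "'w measure" and N :: "'v measure"
    and \<tau> :: "(int ^ 'd::finite) set \<Rightarrow> 'w \<Rightarrow> real"
    and X :: "'d \<Rightarrow> 'v \<Rightarrow> real"
    and F :: "real \<Rightarrow> real"
    and x :: "int ^ 'd"
  assumes dim: "CARD('d) \<ge> 2"
    and prob_M: "prob_space M"
    and indep: "prob_space.indep_vars M (\<lambda>_. borel) \<tau> integer_lines"
    and nonneg: "\<And>\<delta> \<omega>. \<delta> \<in> integer_lines \<Longrightarrow> \<omega> \<in> space M \<Longrightarrow> 0 \<le> \<tau> \<delta> \<omega>"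
    and distr: "\<And>\<delta>. \<delta> \<in> integer_lines \<Longrightarrow> cdf (distr M borel (\<tau> \<delta>)) = F"
    and prob_N: "prob_space N"
    and indep_X: "prob_space.indep_vars N (\<lambda>_. borel) X UNIV"
    and distr_X: "\<And>i. cdf (distr N borel (X i)) = F"
    and min_integrable: "integrable N (\<lambda>\<omega>. MIN i. X i \<omega>)"
  shows "(AE \<omega> in M. (\<lambda>n. passage_time (\<lambda>\<delta>. \<tau> \<delta> \<omega>) 0 (int n *s x) / real n)
            \<longlonglongrightarrow> inf_support F * real_of_int (norm1 x)) \<and>
         (\<forall>n. integrable M (\<lambda>\<omega>. passage_time (\<lambda>\<delta>. \<tau> \<delta> \<omega>) 0 (int n *s x) / real n)) \<and>
         (\<lambda>n. LINT \<omega>|M. \<bar>passage_time (\<lambda>\<delta>. \<tau> \<delta> \<omega>) 0 (int n *s x) / real n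
                - inf_support F * real_of_int (norm1 x)\<bar>) \<longlonglongrightarrow> 0"
proof -
  interpret brochette M \<tau> F
    using prob_M indep nonneg distr by (intro brochette.intro brochette_axioms.intro)
  interpret N: prob_space N by (rule prob_N)
  note \<delta> = line_through_in_integer_lines [of undefined "undefined :: int ^ 'd"]
  let ?\<tau> = "\<tau> (line_through undefined undefined)"
  interpret D: real_distribution "distr M borel ?\<tau>"
    by (rule real_distribution_distr [OF line_time_measurable [OF \<delta>]])
  have F: "F = cdf (distr M borel ?\<tau>)" using distr [OF \<delta>] by simp
  have "F s = 0" if "s < 0" for s
  proof -
    have "?\<tau> -` {..s} \<inter> space M = {}" using nonneg [OF \<delta>] that by force
    then show ?thesis unfolding F cdf_def
      using line_time_measurable [OF \<delta>] by (simp add: measure_distr)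
  qed
  then have a: "0 \<le> inf_support F" "\<And>\<eta>. 0 < \<eta> \<Longrightarrow> 0 < F (inf_support F + \<eta>)"
    "\<And>\<eta>. 0 < \<eta> \<Longrightarrow> F (inf_support F - \<eta>) = 0"
    using inf_support_characterization [of F "inf_support F"] D.cdf_nondecreasing
      D.cdf_is_right_cont D.cdf_lim_at_top_prob unfolding F by auto
  have fin: "(\<Sum>n. excess_bound b (c * real (Suc n))) < top" if "0 < b" "0 < F b" "0 < c" for b c
  proof (rule suminf_excess_bound_finite [OF that(2) _ _ that(3)])
    \<comment> \<open>Shifting the minimum by \<open>2 b\<close> absorbs the cheap sides of the detours.\<close>
    let ?Y = "\<lambda>\<omega>. (MIN i. X i \<omega>) + 2 * b"
    have Y: "integrable N ?Y" using min_integrable by simp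
    show "0 \<le> N.expectation (\<lambda>\<omega>. \<bar>?Y \<omega>\<bar>)" by simp
    fix c :: real assume c: "0 < c"
    have "emeasure N {\<omega> \<in> space N. c * real (Suc n) < ?Y \<omega>} =
        ennreal ((1 - F (c * real (Suc n) - 2 * b)) ^ CARD('d))" for n
    proof -
      have "c * real (Suc n) < ?Y \<omega> \<longleftrightarrow> (\<forall>i. c * real (Suc n) - 2 * b < X i \<omega>)" for \<omega>
      proof -
        have "c * real (Suc n) < ?Y \<omega> \<longleftrightarrow> c * real (Suc n) - 2 * b < (MIN i. X i \<omega>)" by linarith
        also have "\<dots> \<longleftrightarrow> (\<forall>i. c * real (Suc n) - 2 * b < X i \<omega>)" by (subst Min_gr_iff) auto
        finally show ?thesis .
      qed
      then have "{\<omega> \<in> space N. c * real (Suc n) < ?Y \<omega>} =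
          {\<omega> \<in> space N. \<forall>i\<in>UNIV. c * real (Suc n) - 2 * b < X i \<omega>}"
        by blast
      then show ?thesis
        using N.prob_all_greater [OF indep_X _ _ _ distr_X, of UNIV "c * real (Suc n) - 2 * b"]
        by (simp add: N.emeasure_eq_measure)
    qed
    then show "(\<Sum>n. ennreal ((1 - F (c * real (Suc n) - 2 * b)) ^ CARD('d)))
        \<le> ennreal (N.expectation (\<lambda>\<omega>. \<bar>?Y \<omega>\<bar>) / c)"
      using N.suminf_tail_le_expectation [OF Y c] by simp
  qed
  show ?thesis
    by (intro conjI allI time_constant [where a = "inf_support F"] dim a fin)
qed

end
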